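(* Let $\eta\in\mathbb{C}$, $\epsilon\ge0$, and let $\alpha,\beta,r$ be parameters with $\beta>0$ and $\alpha\beta\neq0$. Let $S(n,\eta;\epsilon)=S(n,\eta,\alpha,\beta,r;\epsilon)$, $n\in\mathbb{N}_0$, be the generalized Stirling functions. Then, as an expansion in powers of the complex variable $z$ at $z=0$, $$\frac{1}{\Gamma(\eta+1)}(1+\alpha z)^{r/\alpha}\left(\frac{e^{\epsilon}(1+\alpha z)^{\beta/\alpha}-1}{\beta}\right)^{\eta}=\sum_{n\ge0}S(n,\eta;\epsilon)\frac{z^n}{n!}$$ for $\eta\notin\mathbb{Z}$ and $\epsilon>0$, and $$\frac{1}{k!}(1+\alpha z)^{r/\alpha}\left(\frac{e^{\epsilon}(1+\alpha z)^{\beta/\alpha}-1}{\beta}\right)^{k}=\sum_{n\ge0}S(n,k;\epsilon)\frac{z^n}{n!}$$ for $\eta=k\in\mathbb{N}_0$ and $\epsilon\ge0$.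
   Context: The parameters $\alpha,r$ are real or complex. For $n\in\mathbb{N}_0$, $\langle z\rangle_{n,-\alpha}:=z(z-\alpha)\cdots(z-(n-1)\alpha)$, with $\langle z\rangle_{0,-\alpha}=1$. General binomial coefficients are $\binom{\eta}{j}=\eta(\eta-1)\cdots(\eta-j+1)/j!$. The generalized Stirling functions (with first argument an integer $n$) are $$S(n,\eta;\epsilon)=S(n,\eta,\alpha,\beta,r;\epsilon):=\frac{1}{\beta^{\eta}\,\Gamma(\eta+1)}\sum_{j\ge0}(-1)^j\binom{\eta}{j}e^{(\eta-j)\epsilon}\,\langle r+(\eta-j)\beta\rangle_{n,-\alpha}\qquad(n\neq0),$$ and $S(0,\eta;\epsilon):=\dfrac{(e^{\epsilon}-1)^{\eta}}{\beta^{\eta}\,\Gamma(\eta+1)}$ (with $0^0=1$). Powers are taken with principal branches; near $z=0$ the base $1+\alpha z$ is near $1$, and for $\epsilon>0$ the base $(e^{\epsilon}(1+\alpha z)^{\beta/\alpha}-1)/\beta$ is near the positive number $(e^\epsilon-1)/\beta$. *)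

theory Defs
  imports "HOL-Analysis.Analysis"
begin

text \<open>\<open>gfact \<alpha> n z\<close> is \<open>\<langle>z\<rangle>\<^sub>n\<^sub>,\<^sub>-\<^sub>\<alpha> = z (z - \<alpha>) \<dots> (z - (n - 1) \<alpha>)\<close>.\<close>

definition gfact :: "complex \<Rightarrow> nat \<Rightarrow> complex \<Rightarrow> complex" where
  "gfact \<alpha> n z = (\<Prod>i<n. z - of_nat i * \<alpha>)"

text \<open>
  Principal power with the convention \<open>0\<^sup>0 = 1\<close>; in the library
  \<open>0 powr 0 = 0\<close>.
\<close>

definition cpow :: "complex \<Rightarrow> complex \<Rightarrow> complex" where
  "cpow w \<eta> = (if w = 0 \<and> \<eta> = 0 then 1 else w powr \<eta>)"

text \<open>
  The generalized Stirling function \<open>S(n, \<eta>, \<alpha>, \<beta>, r; \<epsilon>)\<close>. The case \<open>n = 0\<close> is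
  defined separately, not by the series.
\<close>

definition gstirling ::
  "nat \<Rightarrow> complex \<Rightarrow> complex \<Rightarrow> real \<Rightarrow> complex \<Rightarrow> real \<Rightarrow> complex" where
  "gstirling n \<eta> \<alpha> \<beta> r \<epsilon> =
     (if n = 0
      then cpow (of_real (exp \<epsilon> - 1)) \<eta> / (of_real \<beta> powr \<eta> * Gamma (\<eta> + 1))
      else 1 / (of_real \<beta> powr \<eta> * Gamma (\<eta> + 1)) *
           (\<Sum>j. (-1) ^ j * (\<eta> gchoose j) * exp ((\<eta> - of_nat j) * of_real \<epsilon>) *
                gfact \<alpha> n (r + (\<eta> - of_nat j) * of_real \<beta>)))"

end

theory Submission
  imports Defs "HOL-Complex_Analysis.Complex_Analysis"
begin

text \<open>
  Put \<open>s(z) = \<epsilon> + (\<beta>/\<alpha>) Ln (1 + \<alpha> z)\<close>, so that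
  \<open>exp \<epsilon> * (1 + \<alpha> z) powr (\<beta>/\<alpha>) = exp (s(z))\<close>. The binomial series in the small quantity
  \<open>exp (- s)\<close> gives, whenever \<open>Re s > 0\<close> and \<open>Im s\<close> is small enough that no branch cut is crossed,
  \<open>(exp s - 1) powr \<eta> = (\<Sum>j. (-1)\<^sup>j (\<eta> gchoose j) exp ((\<eta> - j) s))\<close>
  (lemma \<open>exp_minus_one_powr_sums\<close>). After multiplication by \<open>(1 + \<alpha> z) powr (r/\<alpha>)\<close>, the summand
  with index \<open>j\<close> is a constant multiple of the single power \<open>(1 + \<alpha> z) powr (a/\<alpha>)\<close> with
  \<open>a = r + (\<eta> - j) \<beta>\<close>. Its Taylor coefficients are \<open>gfact \<alpha> n a / n!\<close>, because
  \<open>\<alpha>\<^sup>n (a/\<alpha>) (a/\<alpha> - 1) \<dots> (a/\<alpha> - n + 1) = a (a - \<alpha>) \<dots> (a - (n - 1) \<alpha>)\<close>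
  (lemma \<open>has_fps_expansion_gfact\<close>). Collecting the coefficients of \<open>z\<^sup>n\<close> over all \<open>j\<close> produces
  exactly the series that defines the generalized Stirling function.

  Two things need care. Interchanging the sum over \<open>j\<close> with the Taylor expansion is justified by
  uniform convergence: \<open>s(0) = \<epsilon> > 0\<close>, so near \<open>0\<close> the real part of \<open>s\<close> stays above \<open>\<epsilon>/2\<close> and
  the summands are dominated by a multiple of \<open>\<bar>\<eta> gchoose j\<bar> exp (- j \<epsilon>/2)\<close>; the Weierstrass
  theorem on locally uniform limits then applies (lemma \<open>has_fps_expansion_suminf\<close>). For
  \<open>\<eta> = k \<in> \<nat>\<close> the sum over \<open>j\<close> is finite, so that \<open>\<epsilon> = 0\<close> is harmless. Secondly, the coefficient
  with \<open>n = 0\<close> is given by a closed form instead of the series; it is read off from the value of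
  the generating function at \<open>z = 0\<close>.
\<close>

section \<open>Power series expansion of a normally convergent series\<close>

text \<open>
  A locally uniform limit of holomorphic functions is holomorphic, and all its derivatives are the
  limits of the derivatives. Applied to the partial sums at \<open>0\<close>, this says that Taylor
  coefficients may be computed term by term; in particular, the series of the \<open>n\<close>-th coefficients
  converges for every \<open>n\<close>.
\<close>

lemma
  fixes f :: "nat \<Rightarrow> complex \<Rightarrow> complex"
  assumes A: "open A" "0 \<in> A"
    and holo: "\<And>j. f j holomorphic_on A"
    and expansion: "\<And>j. f j has_fps_expansion F j"
    and bound: "\<And>j z. z \<in> A \<Longrightarrow> norm (f j z) \<le> M j"
    and M: "summable M"
  shows fps_expansion_suminf_summable: "\<And>n. summable (\<lambda>j. fps_nth (F j) n)"
    and has_fps_expansion_suminf: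
      "(\<lambda>z. \<Sum>j. f j z) has_fps_expansion Abs_fps (\<lambda>n. \<Sum>j. fps_nth (F j) n)"
proof -
  define g where "g = (\<lambda>z. \<Sum>j. f j z)"
  have lim: "uniform_limit A (\<lambda>N z. \<Sum>j<N. f j z) g sequentially"
    unfolding g_def by (rule Weierstrass_m_test[OF bound M])
  have holo_sum: "(\<lambda>z. \<Sum>j<N. f j z) holomorphic_on A" for N
    by (intro holomorphic_intros holo)
  have "g holomorphic_on A"
  proof (rule holomorphic_uniform_sequence[OF A(1) holo_sum])
    fix x assume "x \<in> A"
    then obtain d where "d > 0" "cball x d \<subseteq> A"
      using A(1) open_contains_cball by blast
    then show "\<exists>d>0. cball x d \<subseteq> A \<and> uniform_limit (cball x d) (\<lambda>N z. \<Sum>j<N. f j z) g sequentially"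
      using uniform_limit_on_subset[OF lim] by blast
  qed
  then have g: "g has_fps_expansion fps_expansion g 0"
    by (rule has_fps_expansion_fps_expansion[OF A])
  have "(\<lambda>j. fps_nth (F j) n) sums fps_nth (fps_expansion g 0) n" for n
  proof -
    have "(\<lambda>N. (deriv ^^ n) (\<lambda>z. \<Sum>j<N. f j z) 0) \<longlonglongrightarrow> (deriv ^^ n) g 0"
      by (rule higher_deriv_complex_uniform_limit[OF lim _ _ A]) (simp_all add: holo_sum)
    then have "(\<lambda>N. (deriv ^^ n) (\<lambda>z. \<Sum>j<N. f j z) 0 / fact n) \<longlonglongrightarrow> (deriv ^^ n) g 0 / fact n"
      by (intro tendsto_divide) auto
    moreover have "(deriv ^^ n) (\<lambda>z. \<Sum>j<N. f j z) 0 / fact n = (\<Sum>j<N. fps_nth (F j) n)" for N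
      using fps_nth_fps_expansion[OF has_fps_expansion_sum[of "{..<N}" f F, OF expansion], of n]
      by (simp add: fps_sum_nth)
    ultimately show ?thesis
      by (simp add: sums_def fps_nth_fps_expansion[OF g])
  qed
  then have *: "summable (\<lambda>j. fps_nth (F j) n)"
      "fps_nth (fps_expansion g 0) n = (\<Sum>j. fps_nth (F j) n)" for n
    by (simp_all add: sums_iff)
  show "summable (\<lambda>j. fps_nth (F j) n)" for n
    by (rule *)
  have "fps_expansion g 0 = Abs_fps (\<lambda>n. \<Sum>j. fps_nth (F j) n)"
    by (rule fps_ext) (simp add: *)
  with g show "(\<lambda>z. \<Sum>j. f j z) has_fps_expansion Abs_fps (\<lambda>n. \<Sum>j. fps_nth (F j) n)"
    by (simp add: g_def)
qed


section \<open>Binomial expansions\<close>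

text \<open>
  The rescaling \<open>x = \<alpha> z\<close> of the binomial series contributes a factor \<open>\<alpha>\<^sup>n\<close>, which clears the
  denominators in the \<open>n\<close> factors of \<open>(a/\<alpha>) gchoose n\<close>.
\<close>

lemma has_fps_expansion_gfact:
  assumes "\<alpha> \<noteq> 0"
  shows "(\<lambda>z. (1 + \<alpha> * z) powr (a / \<alpha>)) has_fps_expansion Abs_fps (\<lambda>n. gfact \<alpha> n a / fact n)"
proof -
  have "((\<lambda>x. (1 + x) powr (a / \<alpha>)) \<circ> (\<lambda>z. \<alpha> * z)) has_fps_expansion
          fps_compose (fps_binomial (a / \<alpha>)) (fps_const \<alpha> * fps_X)"
    by (intro has_fps_expansion_compose fps_expansion_intros) simp
  moreover have "fps_compose (fps_binomial (a / \<alpha>)) (fps_const \<alpha> * fps_X) =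
      Abs_fps (\<lambda>n. gfact \<alpha> n a / fact n)"
  proof (rule fps_ext)
    fix n
    have "\<alpha> ^ n * (\<Prod>i<n. a / \<alpha> - of_nat i) = (\<Prod>i<n. \<alpha> * (a / \<alpha> - of_nat i))"
      by (simp add: prod.distrib)
    also have "\<dots> = gfact \<alpha> n a"
      unfolding gfact_def using assms by (intro prod.cong) (auto simp: field_simps)
    finally show "fps_nth (fps_compose (fps_binomial (a / \<alpha>)) (fps_const \<alpha> * fps_X)) n =
        fps_nth (Abs_fps (\<lambda>n. gfact \<alpha> n a / fact n)) n"
      by (simp add: gbinomial_prod_rev atLeast0LessThan)
  qed
  ultimately show ?thesis
    by (simp add: o_def)
qed

text \<open>
  Factor \<open>exp s - 1 = exp s (1 - exp (- s))\<close> and expand the second factor by the binomial series.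
  The principal power respects this factorisation because \<open>1 - exp (- s)\<close> has positive real part,
  hence argument below \<open>\<pi>/2\<close> in modulus, and the assumption on \<open>Im s\<close> leaves room for it inside
  the strip of the principal logarithm.
\<close>

lemma exp_minus_one_powr_sums:
  fixes s \<eta> :: complex
  assumes "Re s > 0" "\<bar>Im s\<bar> \<le> pi / 2"
  shows "(\<lambda>j. (-1) ^ j * (\<eta> gchoose j) * exp ((\<eta> - of_nat j) * s)) sums (exp s - 1) powr \<eta>"
proof -
  define u where "u = exp (- s)"
  have u: "norm u < 1"
    using assms by (simp add: u_def)
  then have "Re u < 1"
    using complex_Re_le_cmod[of u] by linarith
  then have Re: "Re (1 - u) > 0"
    by simp
  then have nz: "1 - u \<noteq> 0"
    by auto
  have im: "\<bar>Im (Ln (1 - u))\<bar> < pi / 2"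
    using Re Re_Ln_pos_lt[OF nz] by simp
  have "exp s - 1 = exp (s + Ln (1 - u))"
    using nz by (simp add: exp_add u_def right_diff_distrib exp_minus)
  also have "Ln \<dots> = s + Ln (1 - u)"
    using im assms by (intro Ln_exp) auto
  finally have Ln: "Ln (exp s - 1) = s + Ln (1 - u)" .
  have "exp s - 1 \<noteq> 0"
    using \<open>exp s - 1 = exp (s + Ln (1 - u))\<close> by simp
  then have powr: "(exp s - 1) powr \<eta> = exp (\<eta> * s) * (1 - u) powr \<eta>"
    using nz by (simp add: powr_def Ln algebra_simps exp_add)
  have "(\<lambda>j. exp (\<eta> * s) * ((\<eta> gchoose j) * (- u) ^ j)) sums (exp (\<eta> * s) * (1 + - u) powr \<eta>)"
    using u by (intro sums_mult gen_binomial_complex) simp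
  moreover have "exp (\<eta> * s) * ((\<eta> gchoose j) * (- u) ^ j) =
      (-1) ^ j * (\<eta> gchoose j) * exp ((\<eta> - of_nat j) * s)" for j
  proof -
    have "exp (\<eta> * s) * u ^ j = exp ((\<eta> - of_nat j) * s)"
      by (simp add: u_def flip: exp_of_nat_mult exp_add) (simp add: algebra_simps)
    then show ?thesis
      by (simp add: power_minus[of u] mult_ac)
  qed
  ultimately show ?thesis
    by (simp add: powr)
qed

lemma summable_norm_gbinomial_exp:
  fixes \<eta> :: complex
  assumes "\<delta> > 0"
  shows "summable (\<lambda>j. norm (\<eta> gchoose j) * exp (- (real j * \<delta>)))"
proof -
  have "summable (\<lambda>j. norm ((\<eta> gchoose j) * complex_of_real (exp (- \<delta>)) ^ j))"
    using assms by (intro abs_summable_in_conv_radius) (simp add: conv_radius_gchoose)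
  then show ?thesis
    by (simp add: norm_mult norm_power flip: exp_of_nat_mult)
qed

section \<open>The generating functions\<close>

text \<open>
  The link between the two shapes of a summand: on the left it is a power of \<open>w = 1 + \<alpha> z\<close>, whose
  Taylor coefficients are known; on the right it is the common factor \<open>w powr (r/\<alpha>)\<close> times a term
  of the binomial series of \<open>exp s - 1\<close>.
\<close>

lemma stirling_summand_exponent:
  fixes r \<alpha> \<beta> \<epsilon> :: complex
  assumes "w \<noteq> 0"
  shows "exp (c * \<epsilon>) * w powr ((r + c * \<beta>) / \<alpha>) =
    w powr (r / \<alpha>) * exp (c * (\<epsilon> + \<beta> / \<alpha> * Ln w))"
  using assms by (simp add: powr_def flip: exp_add) (simp add: algebra_simps add_divide_distrib)

text \<open>
  On a small neighbourhood \<open>A\<close> of \<open>0\<close> the binomial series in \<open>exp (- s(z))\<close> converges to the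
  generating function, and it is dominated there by a convergent series that does not depend on
  \<open>z\<close>. So its coefficients are obtained term by term.
\<close>

lemma
  fixes \<eta> \<alpha> r :: complex and \<beta> \<epsilon> :: real
  assumes "\<epsilon> > 0" and \<alpha>: "\<alpha> \<noteq> 0"
  shows generating_function_powr_summable:
      "\<And>n. summable (\<lambda>j. (-1) ^ j * (\<eta> gchoose j) * exp ((\<eta> - of_nat j) * of_real \<epsilon>) *
          (gfact \<alpha> n (r + (\<eta> - of_nat j) * of_real \<beta>) / fact n))"
    and has_fps_expansion_generating_function_powr:
      "(\<lambda>z. (1 + \<alpha> * z) powr (r / \<alpha>) *
          (exp (of_real \<epsilon>) * (1 + \<alpha> * z) powr (of_real \<beta> / \<alpha>) - 1) powr \<eta>)
        has_fps_expansion Abs_fps (\<lambda>n. \<Sum>j. (-1) ^ j * (\<eta> gchoose j) *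
          exp ((\<eta> - of_nat j) * of_real \<epsilon>) *
          (gfact \<alpha> n (r + (\<eta> - of_nat j) * of_real \<beta>) / fact n))"
proof -
  define s where "s = (\<lambda>z. complex_of_real \<epsilon> + of_real \<beta> / \<alpha> * Ln (1 + \<alpha> * z))"
  define P where "P = (\<lambda>z. (1 + \<alpha> * z) powr (r / \<alpha>))"
  define b where "b = (\<lambda>j. (-1) ^ j * (\<eta> gchoose j) * exp ((\<eta> - of_nat j) * of_real \<epsilon>))"
  define f where "f = (\<lambda>j z. b j *
    (1 + \<alpha> * z) powr ((r + (\<eta> - of_nat j) * of_real \<beta>) / \<alpha>))"
  define F where "F = (\<lambda>j. fps_const (b j) *
    Abs_fps (\<lambda>n. gfact \<alpha> n (r + (\<eta> - of_nat j) * of_real \<beta>) / fact n))"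
  define \<delta> where "\<delta> = \<epsilon> / 2"
  have "\<delta> > 0" using assms by (simp add: \<delta>_def)

  \<comment> \<open>The part of the summands that is independent of \<open>j\<close> is continuous at \<open>0\<close>, so near \<open>0\<close> its
    norm exceeds the value at \<open>0\<close> by at most one.\<close>
  define K where "K = norm (P 0 * exp (\<eta> * s 0)) + 1"
  have cont: "isCont s 0" "isCont (\<lambda>z. P z * exp (\<eta> * s z)) 0"
    unfolding s_def P_def using \<alpha> by (auto intro!: continuous_intros)
  have s0: "s 0 = of_real \<epsilon>"
    by (simp add: s_def)
  \<comment> \<open>Distance \<open>\<delta> = \<epsilon>/2\<close> from \<open>s 0 = \<epsilon>\<close> keeps \<open>Re s\<close> above \<open>\<delta>\<close>; distance \<open>1 \<le> \<pi>/2\<close> keeps \<open>Im s\<close>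
    within the range of \<open>exp_minus_one_powr_sums\<close>.\<close>
  have "eventually (\<lambda>z. dist (s z) (s 0) < min \<delta> 1) (nhds 0)"
    using cont(1)[unfolded continuous_at_eps_delta, rule_format, of "min \<delta> 1"] \<open>\<delta> > 0\<close>
    unfolding eventually_nhds_metric by simp
  moreover have "eventually (\<lambda>z. dist (P z * exp (\<eta> * s z)) (P 0 * exp (\<eta> * s 0)) < 1) (nhds 0)"
    using cont(2)[unfolded continuous_at_eps_delta, rule_format, of 1]
    unfolding eventually_nhds_metric by simp
  moreover have "eventually (\<lambda>z. z \<in> {z. Re (1 + \<alpha> * z) > 0}) (nhds 0)"
    by (intro eventually_nhds_in_open) (auto intro!: open_Collect_less continuous_intros)
  ultimately have "eventually (\<lambda>z. dist (s z) (s 0) < min \<delta> 1 \<and>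
      dist (P z * exp (\<eta> * s z)) (P 0 * exp (\<eta> * s 0)) < 1 \<and> Re (1 + \<alpha> * z) > 0) (nhds 0)"
    by eventually_elim auto
  then obtain A where A: "open A" "0 \<in> A"
    and near: "\<And>z. z \<in> A \<Longrightarrow> dist (s z) (s 0) < min \<delta> 1"
      "\<And>z. z \<in> A \<Longrightarrow> dist (P z * exp (\<eta> * s z)) (P 0 * exp (\<eta> * s 0)) < 1"
      "\<And>z. z \<in> A \<Longrightarrow> Re (1 + \<alpha> * z) > 0"
    unfolding eventually_nhds by blast

  have nz: "1 + \<alpha> * z \<noteq> 0" if "z \<in> A" for z
    using near(3)[OF that] by (metis less_irrefl zero_complex.sel(1))
  have f_eq: "f j z = P z * ((-1) ^ j * (\<eta> gchoose j) * exp ((\<eta> - of_nat j) * s z))"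
    if "z \<in> A" for j z
    using stirling_summand_exponent[OF nz[OF that], of "\<eta> - of_nat j" "of_real \<epsilon>" r "of_real \<beta>" \<alpha>]
    by (simp add: f_def b_def P_def s_def mult_ac)
  have Re_s: "Re (s z) \<ge> \<delta>" and Im_s: "\<bar>Im (s z)\<bar> \<le> pi / 2" if "z \<in> A" for z
    using near(1)[OF that] abs_Re_le_cmod[of "s z - s 0"] abs_Im_le_cmod[of "s z - s 0"] pi_ge_two
    by (auto simp: s0 \<delta>_def dist_norm)
  have K: "norm (P z * exp (\<eta> * s z)) \<le> K" if "z \<in> A" for z
    using near(2)[OF that] norm_triangle_sub[of "P z * exp (\<eta> * s z)" "P 0 * exp (\<eta> * s 0)"]
    unfolding K_def dist_norm by linarith

  have holo: "f j holomorphic_on A" for j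
    unfolding f_def using near(3)
    by (intro holomorphic_intros) (force simp: complex_nonpos_Reals_iff)
  have expansion: "f j has_fps_expansion F j" for j
    unfolding f_def F_def
    by (intro has_fps_expansion_cmult_left has_fps_expansion_gfact \<alpha>)
  have bound: "norm (f j z) \<le> K * (norm (\<eta> gchoose j) * exp (- (real j * \<delta>)))"
    if "z \<in> A" for j z
  proof -
    have "f j z = (-1) ^ j * (P z * exp (\<eta> * s z)) * ((\<eta> gchoose j) * exp (- (of_nat j * s z)))"
      by (simp add: f_eq[OF that] left_diff_distrib exp_diff exp_minus divide_simps)
    then have "norm (f j z) = norm (P z * exp (\<eta> * s z)) *
        (norm (\<eta> gchoose j) * exp (- (real j * Re (s z))))"
      by (simp add: norm_mult norm_power)
    also have "\<dots> \<le> K * (norm (\<eta> gchoose j) * exp (- (real j * \<delta>)))"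
      using Re_s[OF that] K[OF that]
      by (intro mult_mono) (auto intro!: mult_left_mono simp: K_def)
    finally show ?thesis .
  qed
  have M: "summable (\<lambda>j. K * (norm (\<eta> gchoose j) * exp (- (real j * \<delta>))))"
    by (intro summable_mult summable_norm_gbinomial_exp \<open>\<delta> > 0\<close>)

  note series = A holo expansion bound M
  show "summable (\<lambda>j. (-1) ^ j * (\<eta> gchoose j) * exp ((\<eta> - of_nat j) * of_real \<epsilon>) *
          (gfact \<alpha> n (r + (\<eta> - of_nat j) * of_real \<beta>) / fact n))" for n
    using fps_expansion_suminf_summable[OF series, of n] by (simp add: F_def b_def)
  have sum_eq: "(\<Sum>j. f j z) = (1 + \<alpha> * z) powr (r / \<alpha>) *
          (exp (of_real \<epsilon>) * (1 + \<alpha> * z) powr (of_real \<beta> / \<alpha>) - 1) powr \<eta>" if "z \<in> A" for z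
  proof -
    have "(\<lambda>j. f j z) sums (P z * (exp (s z) - 1) powr \<eta>)"
      unfolding f_eq[OF that] using Re_s[OF that] Im_s[OF that] \<open>\<delta> > 0\<close>
      by (intro sums_mult exp_minus_one_powr_sums) auto
    moreover have "exp (s z) = exp (of_real \<epsilon>) * (1 + \<alpha> * z) powr (of_real \<beta> / \<alpha>)"
      using nz[OF that] by (simp add: s_def exp_add powr_def)
    ultimately show ?thesis
      by (simp add: P_def sums_iff)
  qed
  have "eventually (\<lambda>z. z \<in> A) (nhds 0)"
    by (intro eventually_nhds_in_open A)
  then have "eventually (\<lambda>z. (\<Sum>j. f j z) = (1 + \<alpha> * z) powr (r / \<alpha>) *
          (exp (of_real \<epsilon>) * (1 + \<alpha> * z) powr (of_real \<beta> / \<alpha>) - 1) powr \<eta>) (nhds 0)"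
    by eventually_elim (rule sum_eq)
  from has_fps_expansion_cong[OF this refl] has_fps_expansion_suminf[OF series]
  show "(\<lambda>z. (1 + \<alpha> * z) powr (r / \<alpha>) *
          (exp (of_real \<epsilon>) * (1 + \<alpha> * z) powr (of_real \<beta> / \<alpha>) - 1) powr \<eta>)
        has_fps_expansion Abs_fps (\<lambda>n. \<Sum>j. (-1) ^ j * (\<eta> gchoose j) *
          exp ((\<eta> - of_nat j) * of_real \<epsilon>) *
          (gfact \<alpha> n (r + (\<eta> - of_nat j) * of_real \<beta>) / fact n))"
    by (simp add: F_def b_def)
qed

text \<open>
  For a natural exponent the binomial theorem is a finite identity. It needs no smallness of
  \<open>exp (- s(z))\<close>, only \<open>1 + \<alpha> z \<noteq> 0\<close>, and so it covers \<open>\<epsilon> = 0\<close>.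
\<close>

lemma has_fps_expansion_generating_function_power:
  fixes \<alpha> r :: complex and \<beta> \<epsilon> :: real and k :: nat
  assumes \<alpha>: "\<alpha> \<noteq> 0"
  shows "(\<lambda>z. (1 + \<alpha> * z) powr (r / \<alpha>) *
          (exp (of_real \<epsilon>) * (1 + \<alpha> * z) powr (of_real \<beta> / \<alpha>) - 1) ^ k)
        has_fps_expansion Abs_fps (\<lambda>n. \<Sum>j\<le>k. (-1) ^ j * (of_nat k gchoose j) *
          exp ((of_nat k - of_nat j) * of_real \<epsilon>) *
          (gfact \<alpha> n (r + (of_nat k - of_nat j) * of_real \<beta>) / fact n))"
proof -
  define b :: "nat \<Rightarrow> complex" where "b = (\<lambda>j. (-1) ^ j * (of_nat k gchoose j) *
    exp ((of_nat k - of_nat j) * of_real \<epsilon>))"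
  have sum_eq: "(\<Sum>j\<le>k. b j *
        (1 + \<alpha> * z) powr ((r + (of_nat k - of_nat j) * of_real \<beta>) / \<alpha>)) =
      (1 + \<alpha> * z) powr (r / \<alpha>) *
        (exp (of_real \<epsilon>) * (1 + \<alpha> * z) powr (of_real \<beta> / \<alpha>) - 1) ^ k"
    if nz: "1 + \<alpha> * z \<noteq> 0" for z
  proof -
    define w where "w = 1 + \<alpha> * z"
    define s where "s = of_real \<epsilon> + of_real \<beta> / \<alpha> * Ln w"
    have "exp (of_real \<epsilon>) * w powr (of_real \<beta> / \<alpha>) - 1 = - 1 + exp s"
      using nz by (simp add: s_def exp_add powr_def w_def)
    then have "w powr (r / \<alpha>) * (exp (of_real \<epsilon>) * w powr (of_real \<beta> / \<alpha>) - 1) ^ k =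
        (\<Sum>j\<le>k. w powr (r / \<alpha>) * (of_nat (k choose j) * (- 1) ^ j * exp s ^ (k - j)))"
      by (simp only: binomial_ring sum_distrib_left)
    also have "\<dots> = (\<Sum>j\<le>k. b j * w powr ((r + (of_nat k - of_nat j) * of_real \<beta>) / \<alpha>))"
    proof (rule sum.cong)
      fix j assume "j \<in> {..k}"
      then have "exp s ^ (k - j) = exp ((of_nat k - of_nat j) * s)"
        by (simp add: of_nat_diff flip: exp_of_nat_mult)
      then show "w powr (r / \<alpha>) * (of_nat (k choose j) * (- 1) ^ j * exp s ^ (k - j)) =
          b j * w powr ((r + (of_nat k - of_nat j) * of_real \<beta>) / \<alpha>)"
        using stirling_summand_exponent[of w "of_nat k - of_nat j" "of_real \<epsilon>" r "of_real \<beta>" \<alpha>] nz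
        by (simp add: b_def s_def w_def binomial_gbinomial mult_ac)
    qed simp
    finally show ?thesis
      by (simp add: w_def)
  qed
  have "eventually (\<lambda>z. z \<in> {z. 1 + \<alpha> * z \<noteq> 0}) (nhds 0)"
    by (intro eventually_nhds_in_open) (auto intro!: open_Collect_neq continuous_intros)
  then have ev: "eventually (\<lambda>z. (\<Sum>j\<le>k. b j *
        (1 + \<alpha> * z) powr ((r + (of_nat k - of_nat j) * of_real \<beta>) / \<alpha>)) =
      (1 + \<alpha> * z) powr (r / \<alpha>) *
        (exp (of_real \<epsilon>) * (1 + \<alpha> * z) powr (of_real \<beta> / \<alpha>) - 1) ^ k) (nhds 0)"
    by eventually_elim (simp add: sum_eq)
  have "(\<Sum>j\<le>k. fps_const (b j) *
      Abs_fps (\<lambda>n. gfact \<alpha> n (r + (of_nat k - of_nat j) * of_real \<beta>) / fact n)) =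
    Abs_fps (\<lambda>n. \<Sum>j\<le>k. b j * (gfact \<alpha> n (r + (of_nat k - of_nat j) * of_real \<beta>) / fact n))"
    by (rule fps_ext) (simp add: fps_sum_nth)
  from iffD1[OF has_fps_expansion_cong[OF ev this]] show ?thesis
    unfolding b_def
    by (simp add: has_fps_expansion_sum has_fps_expansion_cmult_left has_fps_expansion_gfact \<alpha>)
qed

section \<open>Normalisation\<close>

lemma powr_divide_of_real_pos:
  assumes "\<beta> > 0"
  shows "(w / of_real \<beta>) powr \<eta> = w powr \<eta> / (of_real \<beta> :: complex) powr \<eta>"
proof -
  have "w powr \<eta> = (of_real \<beta> * (w / of_real \<beta>)) powr \<eta>"
    using assms by simp
  also have "\<dots> = of_real \<beta> powr \<eta> * (w / of_real \<beta>) powr \<eta>"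
    using assms by (intro powr_times_real_left) auto
  finally show ?thesis
    using assms by simp
qed

text \<open>
  Apart from the normalising factor, \<open>gstirling\<close> has a closed form for \<open>n = 0\<close> and a series for
  \<open>n > 0\<close>. The closed form is the value at \<open>z = 0\<close> of the generating function, so the two cases are
  matched with a power series \<open>G\<close> separately.
\<close>

lemma normalised_fps_eq_gstirling:
  assumes "fps_nth G 0 = cpow (of_real (exp \<epsilon> - 1)) \<eta>"
    and "\<And>n. n > 0 \<Longrightarrow> fps_nth G n = (\<Sum>j. (-1) ^ j * (\<eta> gchoose j) *
      exp ((\<eta> - of_nat j) * of_real \<epsilon>) * gfact \<alpha> n (r + (\<eta> - of_nat j) * of_real \<beta>)) / fact n"
  shows "fps_const (1 / (of_real \<beta> powr \<eta> * Gamma (\<eta> + 1))) * G =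
    Abs_fps (\<lambda>n. gstirling n \<eta> \<alpha> \<beta> r \<epsilon> / fact n)"
  by (rule fps_ext) (simp add: assms gstirling_def)

theorem theorem3p4:
  fixes \<eta> \<alpha> r :: complex and \<beta> \<epsilon> :: real
  assumes "\<epsilon> \<ge> 0" and "\<beta> > 0" and "\<alpha> * of_real \<beta> \<noteq> 0"
  shows "(\<eta> \<notin> \<int> \<and> \<epsilon> > 0 \<longrightarrow>
           (\<lambda>z. 1 / Gamma (\<eta> + 1) * (1 + \<alpha> * z) powr (r / \<alpha>) *
                ((exp (of_real \<epsilon>) * (1 + \<alpha> * z) powr (of_real \<beta> / \<alpha>) - 1) / of_real \<beta>) powr \<eta>)
           has_fps_expansion Abs_fps (\<lambda>n. gstirling n \<eta> \<alpha> \<beta> r \<epsilon> / fact n)) \<and>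
         (\<forall>k::nat. \<eta> = of_nat k \<longrightarrow>
           (\<lambda>z. 1 / fact k * (1 + \<alpha> * z) powr (r / \<alpha>) *
                ((exp (of_real \<epsilon>) * (1 + \<alpha> * z) powr (of_real \<beta> / \<alpha>) - 1) / of_real \<beta>) ^ k)
           has_fps_expansion Abs_fps (\<lambda>n. gstirling n (of_nat k) \<alpha> \<beta> r \<epsilon> / fact n))"
proof (intro conjI impI allI)
  have \<alpha>: "\<alpha> \<noteq> 0" using assms by auto
  {
    assume "\<eta> \<notin> \<int> \<and> \<epsilon> > 0"
    then have \<epsilon>: "\<epsilon> > 0" by simp
    define G where "G = Abs_fps (\<lambda>n. \<Sum>j. (-1) ^ j * (\<eta> gchoose j) *
      exp ((\<eta> - of_nat j) * of_real \<epsilon>) *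
      (gfact \<alpha> n (r + (\<eta> - of_nat j) * of_real \<beta>) / fact n))"
    have G: "(\<lambda>z. (1 + \<alpha> * z) powr (r / \<alpha>) *
        (exp (of_real \<epsilon>) * (1 + \<alpha> * z) powr (of_real \<beta> / \<alpha>) - 1) powr \<eta>) has_fps_expansion G"
      unfolding G_def by (rule has_fps_expansion_generating_function_powr[OF \<epsilon> \<alpha>])
    have "fps_const (1 / (of_real \<beta> powr \<eta> * Gamma (\<eta> + 1))) * G =
        Abs_fps (\<lambda>n. gstirling n \<eta> \<alpha> \<beta> r \<epsilon> / fact n)"
    proof (rule normalised_fps_eq_gstirling)
      have "exp (complex_of_real \<epsilon>) - 1 \<noteq> 0"
        using \<epsilon> by (simp add: exp_of_real)
      then show "fps_nth G 0 = cpow (of_real (exp \<epsilon> - 1)) \<eta>"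
        using has_fps_expansion_imp_0_eq_fps_nth_0[OF G] by (simp add: cpow_def exp_of_real)
    next
      fix n :: nat
      show "fps_nth G n = (\<Sum>j. (-1) ^ j * (\<eta> gchoose j) * exp ((\<eta> - of_nat j) * of_real \<epsilon>) *
          gfact \<alpha> n (r + (\<eta> - of_nat j) * of_real \<beta>)) / fact n"
        using suminf_mult[OF generating_function_powr_summable[OF \<epsilon> \<alpha>,
          where \<eta> = \<eta> and r = r and \<beta> = \<beta> and n = n], of "fact n"]
        by (simp add: G_def field_simps)
    qed
    moreover have "(\<lambda>z. 1 / (of_real \<beta> powr \<eta> * Gamma (\<eta> + 1)) * ((1 + \<alpha> * z) powr (r / \<alpha>) *
        (exp (of_real \<epsilon>) * (1 + \<alpha> * z) powr (of_real \<beta> / \<alpha>) - 1) powr \<eta>)) has_fps_expansion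
        fps_const (1 / (of_real \<beta> powr \<eta> * Gamma (\<eta> + 1))) * G"
      by (intro has_fps_expansion_cmult_left G)
    ultimately show "(\<lambda>z. 1 / Gamma (\<eta> + 1) * (1 + \<alpha> * z) powr (r / \<alpha>) *
        ((exp (of_real \<epsilon>) * (1 + \<alpha> * z) powr (of_real \<beta> / \<alpha>) - 1) / of_real \<beta>) powr \<eta>)
        has_fps_expansion Abs_fps (\<lambda>n. gstirling n \<eta> \<alpha> \<beta> r \<epsilon> / fact n)"
      by (simp add: powr_divide_of_real_pos[OF \<open>\<beta> > 0\<close>] mult_ac)
  }
  {
    fix k :: nat
    define G :: "complex fps" where "G = Abs_fps (\<lambda>n. \<Sum>j\<le>k. (-1) ^ j * (of_nat k gchoose j) *
      exp ((of_nat k - of_nat j) * of_real \<epsilon>) *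
      (gfact \<alpha> n (r + (of_nat k - of_nat j) * of_real \<beta>) / fact n))"
    have G: "(\<lambda>z. (1 + \<alpha> * z) powr (r / \<alpha>) *
        (exp (of_real \<epsilon>) * (1 + \<alpha> * z) powr (of_real \<beta> / \<alpha>) - 1) ^ k) has_fps_expansion G"
      unfolding G_def by (rule has_fps_expansion_generating_function_power[OF \<alpha>])
    have const: "of_real \<beta> powr of_nat k * Gamma (of_nat k + 1) = (of_real \<beta> ^ k * fact k :: complex)"
      using \<open>\<beta> > 0\<close> by (simp add: powr_nat' Gamma_fact add.commute)
    have "fps_const (1 / (of_real \<beta> powr of_nat k * Gamma (of_nat k + 1))) * G =
        Abs_fps (\<lambda>n. gstirling n (of_nat k) \<alpha> \<beta> r \<epsilon> / fact n)"
    proof (rule normalised_fps_eq_gstirling)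
      \<comment> \<open>At \<open>\<epsilon> = 0\<close> and \<open>k = 0\<close> both sides are \<open>0\<^sup>0 = 1\<close>, thanks to the convention in \<open>cpow\<close>.\<close>
      show "fps_nth G 0 = cpow (of_real (exp \<epsilon> - 1)) (of_nat k)"
        using has_fps_expansion_imp_0_eq_fps_nth_0[OF G]
        by (cases "k = 0") (auto simp: cpow_def exp_of_real powr_nat')
    next
      fix n :: nat
      have "(\<Sum>j. (-1) ^ j * (of_nat k gchoose j) * exp ((of_nat k - of_nat j) * of_real \<epsilon>) *
          gfact \<alpha> n (r + (of_nat k - of_nat j) * of_real \<beta>)) =
        (\<Sum>j\<le>k. (-1) ^ j * (of_nat k gchoose j) * exp ((of_nat k - of_nat j) * of_real \<epsilon>) *
          gfact \<alpha> n (r + (of_nat k - of_nat j) * of_real \<beta>))"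
        by (rule suminf_finite) (auto simp flip: binomial_gbinomial)
      then show "fps_nth G n = (\<Sum>j. (-1) ^ j * (of_nat k gchoose j) *
          exp ((of_nat k - of_nat j) * of_real \<epsilon>) *
          gfact \<alpha> n (r + (of_nat k - of_nat j) * of_real \<beta>)) / fact n"
        by (simp add: G_def sum_divide_distrib)
    qed
    moreover have "(\<lambda>z. 1 / (of_real \<beta> powr of_nat k * Gamma (of_nat k + 1)) *
        ((1 + \<alpha> * z) powr (r / \<alpha>) *
        (exp (of_real \<epsilon>) * (1 + \<alpha> * z) powr (of_real \<beta> / \<alpha>) - 1) ^ k)) has_fps_expansion
        fps_const (1 / (of_real \<beta> powr of_nat k * Gamma (of_nat k + 1))) * G"
      by (intro has_fps_expansion_cmult_left G)
    ultimately show "(\<lambda>z. 1 / fact k * (1 + \<alpha> * z) powr (r / \<alpha>) *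
        ((exp (of_real \<epsilon>) * (1 + \<alpha> * z) powr (of_real \<beta> / \<alpha>) - 1) / of_real \<beta>) ^ k)
        has_fps_expansion Abs_fps (\<lambda>n. gstirling n (of_nat k) \<alpha> \<beta> r \<epsilon> / fact n)"
      unfolding const by (simp add: power_divide mult_ac)
  }
qed

end
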